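(* Let $0\le\lambda_0<\lambda_1\le\infty$ and $I=(\lambda_0,\lambda_1)$. Let $A$ be the event that there exists a node of $T$ on an even level with exactly one child. Then $A$ is rapidly determined on $I$. Moreover, if $F \subset \mathbb{N}$ is any set of levels and $B$ is the event that there exists a node of $T$ on an $F$-level with exactly two children, then $A \cup B$ is rapidly determined on $I$.
   Context: $\mathbb{N} = \{0,1,2,\dots\}$. For $\lambda \in (0,\infty)$, $\mathbb{P}_\lambda$ denotes the law under which $\widetilde{X} = (X_1, X_2, \dots)$ (the seed) is a sequence of i.i.d. Poisson($\lambda$) random variables. The seed determines a rooted ordered tree $T$ (the Poisson Galton–Watson tree) with nodes labelled in breadth first order (top to bottom, left to right, the root being node $1$): node $i$, if it exists, has $X_i$ children. If $T$ has a finite number $n$ of vertices, the values $X_j$, $j>n$, are irrelevant to $T$. The level of a node is its distance from the root (the root is on level $0$, which is even). For a set $F\subset\mathbb{N}$, a node lies on an $F$-level if its level is an element of $F$. Properties of $T$ are viewed as events on the seed. For $k\ge 1$ let $\widetilde{X}^{(k)} = (X_1,\dots,X_k)$. An event $D$ is called $k$-tautologically determined if there exists a set $M \subseteq \mathbb{N}^k$ such that $D = \{\widetilde{X}^{(k)} \in M\}$. An event $D$ is called rapidly determined over an interval $I=(\lambda_0,\lambda_1)$, where $0\le\lambda_0<\lambda_1\le\infty$, if there is a sequence of events $(D_k)_{k\ge1}$ (not depending on $\lambda$), with $D_k$ being $k$-tautologically determined, such that for every $\lambda \in I$ there exist constants $c, C > 0$ and $k_0 \in \mathbb{N}$ (which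 may depend on $\lambda$) with $\mathbb{P}_\lambda(D \triangle D_k) \le C e^{-ck}$ for all $k \ge k_0$. *)

theory Defs
  imports "HOL-Probability.Probability"
begin

text \<open>
  Seeds and node labels are indexed from 0 instead of 1: \<open>X i\<close> is the paper's \<open>X\<^sub>i\<^sub>+\<^sub>1\<close>,
  the root is node \<open>0\<close>, and the first \<open>k\<close> coordinates are \<open>X 0, \<dots>, X (k - 1)\<close>.
\<close>

type_synonym seed = "nat \<Rightarrow> nat"

definition seed_space :: "seed measure" where
  "seed_space = (\<Pi>\<^sub>M i\<in>UNIV. count_space UNIV)"

definition seed_law :: "real \<Rightarrow> seed measure" where
  "seed_law lam = (\<Pi>\<^sub>M i\<in>UNIV. measure_pmf (poisson_pmf lam))"

text \<open>
  In breadth first order the children of node \<open>i\<close> receive the \<open>X i\<close> labels following the root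
  and the children of nodes \<open>0, \<dots>, i - 1\<close>. The formula describes \<open>T\<close> only for labels \<open>i\<close> that
  are reachable from the root; if \<open>T\<close> is finite the other labels are not nodes, and
  \<open>tree_nodes\<close> excludes them.
\<close>

definition children :: "seed \<Rightarrow> nat \<Rightarrow> nat set" where
  "children X i = {Suc (\<Sum>j<i. X j)..(\<Sum>j\<le>i. X j)}"

lemma card_children: "card (children X i) = X i"
  by (simp add: children_def lessThan_Suc_atMost [symmetric])

definition tree_edges :: "seed \<Rightarrow> (nat \<times> nat) set" where
  "tree_edges X = {(i, j). j \<in> children X i}"

definition tree_nodes :: "seed \<Rightarrow> nat set" where
  "tree_nodes X = (tree_edges X)\<^sup>* `` {0}"

definition level :: "seed \<Rightarrow> nat \<Rightarrow> nat" where
  "level X i = (LEAST l. (0, i) \<in> tree_edges X ^^ l)"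

definition exists_node_event :: "nat set \<Rightarrow> nat \<Rightarrow> seed set" where
  "exists_node_event F m =
     {X. \<exists>i \<in> tree_nodes X. level X i \<in> F \<and> card (children X i) = m}"

definition tautologically_determined :: "nat \<Rightarrow> seed set \<Rightarrow> bool" where
  "tautologically_determined k D \<longleftrightarrow>
     (\<exists>M \<subseteq> {xs :: nat list. length xs = k}. D = {X. map X [0..<k] \<in> M})"

text \<open>
  Measurability of \<open>D\<close> is required explicitly, since \<open>measure\<close> is \<open>0\<close> on non-measurable sets.
  Sets that are \<open>k\<close>-tautologically determined are measurable because \<open>M\<close> is countable.
\<close>

definition rapidly_determined :: "ereal \<Rightarrow> ereal \<Rightarrow> seed set \<Rightarrow> bool" where
  "rapidly_determined lam\<^sub>0 lam\<^sub>1 D \<longleftrightarrow>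
     D \<in> sets seed_space \<and>
     (\<exists>E :: nat \<Rightarrow> seed set.
        (\<forall>k\<ge>1. tautologically_determined k (E k)) \<and>
        (\<forall>lam \<in> einterval lam\<^sub>0 lam\<^sub>1. \<exists>c>0. \<exists>C>0. \<exists>k\<^sub>0::nat. \<forall>k\<ge>1. k \<ge> k\<^sub>0 \<longrightarrow>
           measure (seed_law lam) (sym_diff D (E k)) \<le> C * exp (- c * real k)))"

end

theory Submission
  imports Defs
begin

text \<open>
  Approximate the event by evaluating it on the seed whose entries from index \<open>k\<close> on are
  replaced by \<open>0\<close>. An error forces the labels \<open>0, \<dots>, k\<close> to be nodes and every even-level node
  among the first \<open>k\<close> to have a number of children different from \<open>1\<close>. For small \<open>t > 0\<close> the
  product over these even-level nodes of \<open>exp (t (X\<^sub>i + 1))\<close> times the indicator of \<open>X\<^sub>i \<noteq> 1\<close>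
  has mean at most \<open>1\<close>. When an error occurs the product is at least \<open>exp (t k)\<close>, since every
  odd-level node is a child of an even-level one, and Markov's inequality applies.
\<close>

section \<open>Breadth first labels\<close>

text \<open>The nodes before \<open>j\<close> and all their children occupy the labels up to
  \<open>sum X {..<j}\<close>, so the condition says that the breadth first exploration does not run
  out of nodes before reaching \<open>i\<close>.\<close>

definition alive :: "seed \<Rightarrow> nat \<Rightarrow> bool" where
  "alive X i \<longleftrightarrow> (\<forall>j\<le>i. j \<le> sum X {..<j})"

lemma mem_children_iff: "j \<in> children X i \<longleftrightarrow> sum X {..<i} < j \<and> j \<le> sum X {..<Suc i}"
  by (auto simp: children_def lessThan_Suc_atMost)

lemma sum_lessThan_mono: "i \<le> j \<Longrightarrow> sum X {..<i} \<le> sum X {..<j}" for X :: seed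
  by (rule sum_mono2) auto

lemma alive_mono: "alive X i \<Longrightarrow> j \<le> i \<Longrightarrow> alive X j"
  by (simp add: alive_def)

text \<open>Up to \<open>i\<close> the inequality is inherited; beyond \<open>i\<close> the partial
  sums already include the child block of \<open>i\<close>, hence are at least
  \<open>j\<close>.\<close>

lemma alive_child:
  assumes "alive X i" and "j \<in> children X i"
  shows "alive X j"
  unfolding alive_def
proof (intro allI impI)
  fix m assume "m \<le> j"
  show "m \<le> sum X {..<m}"
  proof (cases "m \<le> i")
    case True
    then show ?thesis using assms(1) by (simp add: alive_def)
  next
    case False
    then have "sum X {..<Suc i} \<le> sum X {..<m}" by (intro sum_lessThan_mono) simp
    then show ?thesis using assms(2) \<open>m \<le> j\<close> unfolding mem_children_iff by linarith
  qed
qed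

lemma alive_has_parent:
  assumes "alive X j" and "0 < j"
  obtains p where "p < j" "alive X p" "j \<in> children X p"
proof -
  \<comment> \<open>The parent is the first index whose partial sum reaches \<open>j\<close>;
    minimality gives the strict lower bound, and aliveness of \<open>j\<close> gives
    \<open>p < j\<close>.\<close>
  define p where "p = (LEAST p. j \<le> sum X {..<Suc p})"
  have ex: "j \<le> sum X {..<Suc (j - 1)}" using assms by (simp add: alive_def)
  have le: "j \<le> sum X {..<Suc p}" unfolding p_def by (rule LeastI, rule ex)
  have "p \<le> j - 1" unfolding p_def by (rule Least_le, rule ex)
  then have "p < j" using assms(2) by simp
  have "sum X {..<p} < j"
  proof (cases p)
    case 0
    then show ?thesis using assms(2) by simp
  next
    case (Suc q)
    then have "q < (LEAST p. j \<le> sum X {..<Suc p})" unfolding p_def by linarith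
    then have "\<not> j \<le> sum X {..<Suc q}" by (rule not_less_Least)
    then show ?thesis using Suc by simp
  qed
  with le have "j \<in> children X p" by (simp only: mem_children_iff)
  with \<open>p < j\<close> show thesis using that alive_mono[OF assms(1)] by simp
qed

lemma parent_unique:
  assumes "j \<in> children X p" and "j \<in> children X q"
  shows "p = q"
proof (rule linorder_cases)
  assume "p < q"
  then have "sum X {..<Suc p} \<le> sum X {..<q}" by (intro sum_lessThan_mono) simp
  then show ?thesis using assms unfolding mem_children_iff by linarith
next
  assume "q < p"
  then have "sum X {..<Suc q} \<le> sum X {..<p}" by (intro sum_lessThan_mono) simp
  then show ?thesis using assms unfolding mem_children_iff by linarith
qed

text \<open>Replaces reachability by inequalities between partial sums. Aliveness passes along
  edges; conversely, strong induction applies because a parent has a smaller label.\<close>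

lemma tree_nodes_eq: "tree_nodes X = {i. alive X i}"
proof (intro subset_antisym subsetI)
  fix i assume "i \<in> tree_nodes X"
  then have "(0, i) \<in> (tree_edges X)\<^sup>*" by (simp add: tree_nodes_def)
  then have "alive X i"
  proof induction
    case base
    then show ?case by (simp add: alive_def)
  next
    case (step i j)
    then show ?case using alive_child by (simp add: tree_edges_def)
  qed
  then show "i \<in> {i. alive X i}" by simp
next
  fix i assume "i \<in> {i. alive X i}"
  then have "alive X i" by simp
  then have "(0, i) \<in> (tree_edges X)\<^sup>*"
  proof (induction i rule: less_induct)
    case (less i)
    show ?case
    proof (cases "i = 0")
      case False
      then obtain p where "p < i" "alive X p" "i \<in> children X p"
        using alive_has_parent[OF less.prems] by blast
      then have "(0, p) \<in> (tree_edges X)\<^sup>*" "(p, i) \<in> tree_edges X"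
        using less.IH[of p] by (simp_all add: tree_edges_def)
      then show ?thesis by (rule rtrancl_into_rtrancl)
    qed simp
  qed
  then show "i \<in> tree_nodes X" by (simp add: tree_nodes_def)
qed

lemma level_root: "level X 0 = 0"
  by (simp add: level_def)

text \<open>The parent is unique, so every path to \<open>j\<close> ends with the edge from
  \<open>i\<close>; child labels are positive, so the empty path is excluded. Path lengths therefore
  shift by exactly one.\<close>

lemma level_child:
  assumes "alive X i" and "j \<in> children X i"
  shows "level X j = Suc (level X i)"
proof -
  have "i \<in> tree_nodes X" using assms(1) by (simp add: tree_nodes_eq)
  then obtain l where l: "(0, i) \<in> tree_edges X ^^ l"
    by (auto simp: tree_nodes_def rtrancl_power)
  have step: "(0, j) \<in> tree_edges X ^^ Suc m \<longleftrightarrow> (0, i) \<in> tree_edges X ^^ m" for m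
  proof
    assume "(0, j) \<in> tree_edges X ^^ Suc m"
    then obtain q where q: "(0, q) \<in> tree_edges X ^^ m" "(q, j) \<in> tree_edges X"
      by (rule relpow_Suc_E)
    then have "q = i" using assms(2) by (intro parent_unique) (simp_all add: tree_edges_def)
    then show "(0, i) \<in> tree_edges X ^^ m" using q(1) by simp
  next
    assume "(0, i) \<in> tree_edges X ^^ m"
    moreover have "(i, j) \<in> tree_edges X" using assms(2) by (simp add: tree_edges_def)
    ultimately show "(0, j) \<in> tree_edges X ^^ Suc m" by (rule relpow_Suc_I)
  qed
  have "(LEAST l. (0, j) \<in> tree_edges X ^^ l) = Suc (LEAST m. (0, j) \<in> tree_edges X ^^ Suc m)"
  proof (rule Least_Suc)
    show "(0, j) \<in> tree_edges X ^^ Suc l" using l step by blast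
    show "(0, j) \<notin> tree_edges X ^^ 0" using assms(2) by (simp add: children_def)
  qed
  then show ?thesis by (simp only: level_def step)
qed

lemma exists_node_event_eq:
  "exists_node_event F m = {X. \<exists>i. alive X i \<and> level X i \<in> F \<and> X i = m}"
  by (auto simp: exists_node_event_def tree_nodes_eq card_children)

section \<open>Dependence on finitely many coordinates\<close>

text \<open>Polymorphic in the result, so that one notion serves events, the choice of factors and
  the \<open>ennreal\<close> products.\<close>

definition prefix_determined :: "nat \<Rightarrow> (seed \<Rightarrow> 'b) \<Rightarrow> bool" where
  "prefix_determined k f \<longleftrightarrow> (\<forall>X Y. (\<forall>i<k. X i = Y i) \<longrightarrow> f X = f Y)"

lemma prefix_determinedI:
  "(\<And>X Y. (\<And>i. i < k \<Longrightarrow> X i = Y i) \<Longrightarrow> f X = f Y) \<Longrightarrow> prefix_determined k f"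
  unfolding prefix_determined_def by blast

lemma prefix_determinedD:
  "prefix_determined k f \<Longrightarrow> (\<And>i. i < k \<Longrightarrow> X i = Y i) \<Longrightarrow> f X = f Y"
  unfolding prefix_determined_def by blast

lemma alive_cong:
  assumes "\<And>j. j < i \<Longrightarrow> X j = Y j"
  shows "alive X i \<longleftrightarrow> alive Y i"
proof -
  have "sum X {..<j} = sum Y {..<j}" if "j \<le> i" for j
    using assms that by (intro sum.cong) auto
  then show ?thesis by (simp add: alive_def)
qed

text \<open>\<open>level\<close> is defined from the whole edge relation; descending through
  parents, whose labels are smaller, shows that only entries before \<open>i\<close> matter.\<close>

lemma level_cong:
  assumes "alive X i" and "\<And>j. j < i \<Longrightarrow> X j = Y j"
  shows "level X i = level Y i"
  using assms
proof (induction i rule: less_induct)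
  case (less i)
  show ?case
  proof (cases "i = 0")
    case False
    then obtain p where p: "p < i" "alive X p" "i \<in> children X p"
      using alive_has_parent[OF less.prems(1)] by blast
    have "alive Y p" using p alive_cong[of p X Y] less.prems(2) by simp
    moreover have "sum X {..<p} = sum Y {..<p}" "sum X {..<Suc p} = sum Y {..<Suc p}"
      using p(1) less.prems(2) by (auto intro!: sum.cong)
    with p(3) have "i \<in> children Y p" unfolding mem_children_iff by simp
    ultimately show ?thesis
      using p less.IH[OF p(1)] less.prems(2) by (simp add: level_child)
  qed (simp add: level_root)
qed

definition node_at :: "nat set \<Rightarrow> nat \<Rightarrow> seed \<Rightarrow> bool" where
  "node_at F i X \<longleftrightarrow> alive X i \<and> level X i \<in> F"

text \<open>The bound is \<open>i\<close>, not \<open>Suc i\<close>: the status of label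
  \<open>i\<close> is known before \<open>X i\<close> is revealed. This predictability drives the
  mean bound for products.\<close>

lemma prefix_determined_node_at: "prefix_determined i (node_at F i)"
  unfolding node_at_def
  by (rule prefix_determinedI) (metis alive_cong level_cong)

lemma prefix_determined_iff_map_mem:
  assumes "prefix_determined k P"
  shows "P X \<longleftrightarrow> map X [0..<k] \<in> (\<lambda>X. map X [0..<k]) ` Collect P"
proof
  assume "map X [0..<k] \<in> (\<lambda>X. map X [0..<k]) ` Collect P"
  then obtain Y where "map X [0..<k] = map Y [0..<k]" and "P Y" by blast
  moreover have "P X = P Y"
    by (rule prefix_determinedD[OF assms]) (use \<open>map X _ = _\<close> in simp)
  ultimately show "P X" by blast
qed blast

text \<open>The prefix map takes values in the countable type of lists, so singletons suffice, and
  their preimages are finite intersections of coordinate events. The general index set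
  \<open>I\<close> covers both the finite products and the seed space.\<close>

lemma prefix_determined_sets:
  assumes "prefix_determined k P" and "{..<k} \<subseteq> I"
  shows "{X \<in> space (\<Pi>\<^sub>M i\<in>I. count_space UNIV). P X} \<in> sets (\<Pi>\<^sub>M i\<in>I. count_space UNIV)"
    (is "_ \<in> sets ?M")
proof -
  have *: "(\<lambda>X. map X [0..<k]) \<in> measurable ?M (count_space UNIV)"
  proof (subst measurable_count_space_eq2_countable, intro conjI ballI)
    fix xs :: "nat list"
    have eq: "(\<lambda>X. map X [0..<k]) -` {xs} \<inter> space ?M
        = {X \<in> space ?M. length xs = k \<and> (\<forall>i\<in>{..<k}. X i = xs ! i)}"
      by (auto intro!: nth_equalityI)
    have coord: "{X \<in> space ?M. X i = xs ! i} \<in> sets ?M" if "i \<in> {..<k}" for i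
    proof -
      have "(\<lambda>X. X i) \<in> measurable ?M (count_space UNIV)"
        using that assms(2) by (intro measurable_component_singleton) blast
      from measurable_sets[OF this, of "{xs ! i}"] show ?thesis
        by (simp add: vimage_def Int_def conj_commute)
    qed
    have "{X \<in> space ?M. \<forall>i\<in>{..<k}. X i = xs ! i} \<in> sets ?M"
      by (rule sets.sets_Collect_finite_All) (erule coord, simp)
    then show "(\<lambda>X. map X [0..<k]) -` {xs} \<inter> space ?M \<in> sets ?M"
      unfolding eq by (rule sets.sets_Collect_conj[OF _ sets.sets_Collect_const])
  qed auto
  have "{X \<in> space ?M. P X}
      = (\<lambda>X. map X [0..<k]) -` ((\<lambda>X. map X [0..<k]) ` Collect P) \<inter> space ?M"
    unfolding vimage_def prefix_determined_iff_map_mem[OF assms(1), symmetric] by blast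
  also have "\<dots> \<in> sets ?M" by (rule measurable_sets[OF *]) simp
  finally show ?thesis .
qed

lemma prefix_determined_measurable:
  assumes "prefix_determined k f" and "{..<k} \<subseteq> I" and "space N = UNIV"
  shows "f \<in> measurable (\<Pi>\<^sub>M i\<in>I. count_space UNIV) N"
proof (rule measurableI)
  fix A
  have "prefix_determined k (\<lambda>X. f X \<in> A)"
    using assms(1) unfolding prefix_determined_def by metis
  from prefix_determined_sets[OF this assms(2)]
  show "f -` A \<inter> space (\<Pi>\<^sub>M i\<in>I. count_space UNIV) \<in> sets (\<Pi>\<^sub>M i\<in>I. count_space UNIV)"
    by (simp add: vimage_def Int_def conj_commute)
qed (simp add: assms(3))

lemma prefix_determined_seed_space:
  "prefix_determined k P \<Longrightarrow> {X. P X} \<in> sets seed_space"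
  using prefix_determined_sets[of k P UNIV] by (simp add: seed_space_def space_PiM)

lemma tautologically_determinedI:
  assumes "prefix_determined k P"
  shows "tautologically_determined k {X. P X}"
  unfolding tautologically_determined_def
proof (intro exI conjI)
  show "{X. P X} = {X. map X [0..<k] \<in> (\<lambda>X. map X [0..<k]) ` Collect P}"
    unfolding prefix_determined_iff_map_mem[OF assms, symmetric] ..
qed auto

text \<open>A countable union over labels: the event for label \<open>i\<close> reads
  \<open>i\<close> entries to recognise the node and one more for its number of children.\<close>

lemma exists_node_event_sets: "exists_node_event F m \<in> sets seed_space"
proof -
  have "prefix_determined (Suc i) (\<lambda>X. node_at F i X \<and> X i = m)" for i
  proof (rule prefix_determinedI)
    fix X Y :: seed assume eq: "\<And>j. j < Suc i \<Longrightarrow> X j = Y j"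
    have "node_at F i X = node_at F i Y"
      by (rule prefix_determinedD[OF prefix_determined_node_at]) (use eq in simp)
    then show "(node_at F i X \<and> X i = m) = (node_at F i Y \<and> Y i = m)" using eq by simp
  qed
  then have "(\<Union>i. {X. node_at F i X \<and> X i = m}) \<in> sets seed_space"
    by (intro sets.countable_UN) (auto intro: prefix_determined_seed_space)
  also have "(\<Union>i. {X. node_at F i X \<and> X i = m}) = exists_node_event F m"
    by (auto simp: exists_node_event_eq node_at_def)
  finally show ?thesis .
qed

section \<open>Exponential decay\<close>

lemma sets_seed_law: "sets (seed_law lam) = sets seed_space"
  unfolding seed_law_def seed_space_def by (intro sets_PiM_cong) auto

text \<open>A supermartingale argument: factor \<open>i\<close> is switched on by coordinates before
  \<open>i\<close>, so integrating out the last coordinate multiplies the remaining product by at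
  most 1.\<close>

lemma nn_integral_predictable_prod_le_1:
  fixes p :: "nat pmf" and w :: "nat \<Rightarrow> ennreal"
  assumes w: "(\<integral>\<^sup>+x. w x \<partial>measure_pmf p) \<le> 1" and e: "\<And>i. prefix_determined i (e i)"
  shows "(\<integral>\<^sup>+X. (\<Prod>i<k. if e i X then w (X i) else 1) \<partial>(\<Pi>\<^sub>M i\<in>UNIV. measure_pmf p)) \<le> 1"
proof -
  interpret P: product_prob_space "\<lambda>_ :: nat. measure_pmf p" UNIV by unfold_locales
  define G where "G k X = (\<Prod>i<k. if e i X then w (X i) else 1)" for k X
  have pd: "prefix_determined k (G k)" for k
  proof (rule prefix_determinedI)
    fix X Y :: seed assume eq: "\<And>i. i < k \<Longrightarrow> X i = Y i"
    have "e i X = e i Y" if "i < k" for i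
      by (rule prefix_determinedD[OF e]) (use eq that in auto)
    then show "G k X = G k Y" unfolding G_def using eq by (intro prod.cong) simp_all
  qed
  have sets_eq: "sets (\<Pi>\<^sub>M i\<in>I. measure_pmf p) = sets (\<Pi>\<^sub>M i\<in>I. count_space UNIV)" for I :: "nat set"
    by (intro sets_PiM_cong) auto
  have meas: "G k \<in> borel_measurable (\<Pi>\<^sub>M i\<in>I. measure_pmf p)" if "{..<k} \<subseteq> I" for k I
    using prefix_determined_measurable[OF pd that, of borel]
    by (simp add: measurable_cong_sets[OF sets_eq refl])
  have "(\<integral>\<^sup>+X. G k X \<partial>(\<Pi>\<^sub>M i\<in>{..<k}. measure_pmf p)) \<le> 1" for k
  proof (induction k)
    case 0
    then show ?case using P.emeasure_space_1 by (simp add: G_def PiM_empty)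
  next
    case (Suc k)
    have upd: "G (Suc k) (X(k := y)) = G k X * (if e k X then w y else 1)" for X y
    proof -
      have "G k (X(k := y)) = G k X" by (rule prefix_determinedD[OF pd]) simp
      moreover have "e k (X(k := y)) = e k X" by (rule prefix_determinedD[OF e]) simp
      ultimately show ?thesis by (simp add: G_def)
    qed
    have inner: "(\<integral>\<^sup>+y. G (Suc k) (X(k := y)) \<partial>measure_pmf p) \<le> G k X" for X
    proof -
      have "(\<integral>\<^sup>+y. (if e k X then w y else 1) \<partial>measure_pmf p) \<le> 1"
        using w by (cases "e k X") (auto simp: measure_pmf.emeasure_space_1)
      then have "G k X * (\<integral>\<^sup>+y. (if e k X then w y else 1) \<partial>measure_pmf p) \<le> G k X * 1"
        by (rule mult_left_mono) simp
      then show ?thesis by (simp add: upd nn_integral_cmult)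
    qed
    have "(\<integral>\<^sup>+X. G (Suc k) X \<partial>(\<Pi>\<^sub>M i\<in>insert k {..<k}. measure_pmf p))
        = (\<integral>\<^sup>+X. (\<integral>\<^sup>+y. G (Suc k) (X(k := y)) \<partial>measure_pmf p) \<partial>(\<Pi>\<^sub>M i\<in>{..<k}. measure_pmf p))"
      by (rule P.product_nn_integral_insert) (auto intro!: meas)
    also have "\<dots> \<le> (\<integral>\<^sup>+X. G k X \<partial>(\<Pi>\<^sub>M i\<in>{..<k}. measure_pmf p))"
      by (intro nn_integral_mono inner)
    also have "\<dots> \<le> 1" by (rule Suc.IH)
    finally show ?case by (simp add: lessThan_Suc)
  qed
  \<comment> \<open>Finite products allow splitting off one coordinate at a time; the bound moves to
    the infinite product because its marginal on the first \<open>k\<close> coordinates is the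
    finite one.\<close>
  also have "(\<integral>\<^sup>+X. G k X \<partial>(\<Pi>\<^sub>M i\<in>{..<k}. measure_pmf p))
      = (\<integral>\<^sup>+X. G k X \<partial>distr (\<Pi>\<^sub>M i\<in>UNIV. measure_pmf p) (\<Pi>\<^sub>M i\<in>{..<k}. measure_pmf p)
          (\<lambda>X. restrict X {..<k}))"
    by (subst P.distr_PiM_restrict_finite) auto
  also have "\<dots> = (\<integral>\<^sup>+X. G k (restrict X {..<k}) \<partial>(\<Pi>\<^sub>M i\<in>UNIV. measure_pmf p))"
    by (rule nn_integral_distr) (auto intro!: measurable_restrict_subset meas)
  also have "\<dots> = (\<integral>\<^sup>+X. G k X \<partial>(\<Pi>\<^sub>M i\<in>UNIV. measure_pmf p))"
    by (intro nn_integral_cong prefix_determinedD[OF pd]) simp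
  finally show ?thesis by (simp add: G_def)
qed

section \<open>Exponential moment of the Poisson law without the value 1\<close>

definition weight :: "real \<Rightarrow> nat \<Rightarrow> ennreal" where
  "weight t n = (if n = 1 then 0 else ennreal (exp (t * (real n + 1))))"

text \<open>The exponential series yields the full moment
  \<open>exp (t - lam) * exp (lam * exp t)\<close>; the subtracted part is its term
  \<open>n = 1\<close>.\<close>

lemma nn_integral_weight:
  assumes "0 < lam"
  shows "(\<integral>\<^sup>+n. weight t n \<partial>measure_pmf (poisson_pmf lam))
    = ennreal (exp (t - lam) * (exp (lam * exp t) - lam * exp t))"
proof -
  define c where "c = exp (t - lam)"
  define f where "f n = c * ((lam * exp t) ^ n / fact n)" for n :: nat
  have f_eq: "pmf (poisson_pmf lam) n * exp (t * (real n + 1)) = f n" for n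
  proof -
    have "t * (real n + 1) = t + real n * t" by (simp add: algebra_simps)
    then have "exp (t * (real n + 1)) = exp t * exp t ^ n"
      by (simp only: exp_add exp_of_nat_mult)
    then show ?thesis
      using assms by (simp add: f_def c_def power_mult_distrib exp_diff exp_minus divide_inverse)
  qed
  have "f sums (c * exp (lam * exp t))"
    unfolding f_def using exp_converges[of "lam * exp t"]
    by (intro sums_mult) (simp add: divide_inverse mult.commute)
  then have "(\<lambda>n. f n - (if n = 1 then f n else 0)) sums (c * exp (lam * exp t) - f 1)"
    by (intro sums_diff sums_single)
  then have sums: "(\<lambda>n. if n = 1 then 0 else f n) sums (c * (exp (lam * exp t) - lam * exp t))"
    by (simp add: f_def algebra_simps if_distrib cong: if_cong)
  have f_nonneg: "0 \<le> f n" for n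
    using assms by (simp add: f_def c_def)
  have "(\<integral>\<^sup>+n. weight t n \<partial>measure_pmf (poisson_pmf lam))
      = (\<integral>\<^sup>+n. ennreal (if n = 1 then 0 else f n) \<partial>count_space UNIV)"
    unfolding nn_integral_measure_pmf
    by (intro nn_integral_cong) (simp add: weight_def ennreal_mult'[symmetric] f_eq del: pmf_poisson)
  also have "\<dots> = (\<Sum>n. ennreal (if n = 1 then 0 else f n))"
    by (rule nn_integral_count_space_nat)
  also have "\<dots> = ennreal (c * (exp (lam * exp t) - lam * exp t))"
    using sums f_nonneg by (intro suminf_ennreal_eq) auto
  finally show ?thesis by (simp add: c_def)
qed

text \<open>At \<open>t = 0\<close> the mean is the probability of not having exactly one child,
  \<open>1 - lam * exp (- lam)\<close>, strictly below 1 because \<open>lam\<close> is positive;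
  continuity leaves room for some \<open>t > 0\<close>.\<close>

lemma exists_exponent:
  fixes lam :: real
  assumes "0 < lam"
  obtains t where "0 < t" and "(\<integral>\<^sup>+n. weight t n \<partial>measure_pmf (poisson_pmf lam)) \<le> 1"
proof -
  let ?g = "\<lambda>t. exp (t - lam) * (exp (lam * exp t) - lam * exp t)"
  have "isCont ?g 0" by (intro continuous_intros)
  then have "(?g \<longlongrightarrow> ?g 0) (at_right 0)"
    unfolding isCont_def by (rule tendsto_mono[OF at_le, rotated]) simp
  moreover have "?g 0 < 1"
    using assms by (simp add: algebra_simps exp_minus)
  ultimately have "eventually (\<lambda>t. ?g t < 1) (at_right 0)"
    by (rule order_tendstoD)
  then have "eventually (\<lambda>t. ?g t < 1 \<and> 0 < t) (at_right (0::real))"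
    by (intro eventually_conj) (auto simp: eventually_at_right_less)
  then obtain t where "?g t < 1" "0 < t"
    using eventually_happens'[of "at_right (0::real)"] by force
  then show thesis
    using that[of t] nn_integral_weight[OF assms, of t] by (simp add: ennreal_le_1)
qed

section \<open>Counting nodes by even levels, and Markov's inequality\<close>

definition undecided :: "nat \<Rightarrow> seed \<Rightarrow> bool" where
  "undecided k X \<longleftrightarrow> alive X k \<and> (\<forall>i<k. node_at {l. even l} i X \<longrightarrow> X i \<noteq> 1)"

lemma prefix_determined_undecided: "prefix_determined k (undecided k)"
proof (rule prefix_determinedI)
  fix X Y :: seed assume eq: "\<And>i. i < k \<Longrightarrow> X i = Y i"
  have "alive X k = alive Y k" by (rule alive_cong) (rule eq)
  moreover have "node_at {l. even l} i X = node_at {l. even l} i Y" if "i < k" for i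
    by (rule prefix_determinedD[OF prefix_determined_node_at]) (use eq that in auto)
  ultimately show "undecided k X = undecided k Y" using eq by (simp add: undecided_def)
qed

text \<open>The parent of an odd-level label has even level and a smaller label, so the odd-level
  labels below \<open>k\<close> lie in the child blocks of the even-level ones below
  \<open>k\<close>. The \<open>Suc\<close> counts each even-level node itself.\<close>

lemma le_sum_even_nodes:
  assumes "alive X k"
  shows "k \<le> (\<Sum>i | i < k \<and> even (level X i). Suc (X i))"
proof -
  let ?E = "{i. i < k \<and> even (level X i)}" and ?O = "{i. i < k \<and> odd (level X i)}"
  have "?O \<subseteq> (\<Union>i\<in>?E. children X i)"
  proof
    fix j assume j: "j \<in> ?O"
    then have "alive X j" using alive_mono[OF assms] by simp
    \<comment> \<open>The root has even level, so an odd-level label has a parent.\<close>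
    moreover have "0 < j" using j by (auto simp: level_root intro!: Nat.gr0I)
    ultimately obtain p where p: "p < j" "alive X p" "j \<in> children X p"
      by (rule alive_has_parent)
    then have "p \<in> ?E" using j level_child[OF p(2,3)] by auto
    then show "j \<in> (\<Union>i\<in>?E. children X i)" using p(3) by blast
  qed
  then have "card ?O \<le> card (\<Union>i\<in>?E. children X i)"
    by (intro card_mono) (auto simp: children_def)
  also have "\<dots> \<le> (\<Sum>i\<in>?E. X i)"
    using card_UN_le[of ?E "children X"] by (simp add: card_children)
  finally have "card ?O \<le> (\<Sum>i\<in>?E. X i)" .
  moreover have "k = card ?E + card ?O"
  proof -
    have "{..<k} = ?E \<union> ?O" by auto
    then have "k = card (?E \<union> ?O)" by (metis card_lessThan)
    also have "\<dots> = card ?E + card ?O" by (rule card_Un_disjoint) auto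
    finally show ?thesis .
  qed
  ultimately show ?thesis by (simp add: sum_Suc)
qed

text \<open>On \<open>undecided\<close> no factor vanishes, so the product is the exponential of
  \<open>t\<close> times the sum bounded in \<open>le_sum_even_nodes\<close>.\<close>

lemma exp_le_prod_weight:
  assumes "0 < t" and "undecided k X"
  shows "ennreal (exp (t * k))
    \<le> (\<Prod>i<k. if node_at {l. even l} i X then weight t (X i) else 1)"
proof -
  let ?E = "{i. i < k \<and> even (level X i)}"
  have alive: "alive X k" and ne: "\<And>i. i \<in> ?E \<Longrightarrow> X i \<noteq> 1"
    using assms(2) alive_mono[of X k] by (auto simp: undecided_def node_at_def)
  have "exp (t * k) \<le> exp (t * (\<Sum>i\<in>?E. Suc (X i)))"
    using le_sum_even_nodes[OF alive] assms(1) by (simp only: exp_le_cancel_iff mult_le_cancel_left_pos of_nat_le_iff)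
  also have "\<dots> = (\<Prod>i\<in>?E. exp (t * (real (X i) + 1)))"
    by (simp add: sum_distrib_left exp_sum add.commute del: sum_Suc)
  finally have "ennreal (exp (t * k)) \<le> ennreal (\<Prod>i\<in>?E. exp (t * (real (X i) + 1)))"
    by (rule ennreal_leI)
  also have "\<dots> = (\<Prod>i\<in>?E. weight t (X i))"
    using ne by (subst prod_ennreal[symmetric]) (auto simp: weight_def intro!: prod.cong)
  \<comment> \<open>All labels below \<open>k\<close> are alive, so for them \<open>node_at\<close>
    only tests the parity of the level.\<close>
  also have "\<dots> = (\<Prod>i<k. if node_at {l. even l} i X then weight t (X i) else 1)"
    using alive_mono[OF alive]
    by (subst prod.inter_filter[symmetric]) (auto simp: node_at_def intro!: prod.cong)
  finally show ?thesis .
qed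

lemma measure_undecided_le:
  assumes "0 < t" and "(\<integral>\<^sup>+n. weight t n \<partial>measure_pmf (poisson_pmf lam)) \<le> 1"
  shows "measure (seed_law lam) {X. undecided k X} \<le> exp (- t * k)"
proof -
  let ?B = "{X. undecided k X}"
  have B: "?B \<in> sets (seed_law lam)"
    unfolding sets_seed_law by (rule prefix_determined_seed_space[OF prefix_determined_undecided])
  have "ennreal (exp (t * k)) * emeasure (seed_law lam) ?B
      = (\<integral>\<^sup>+X. ennreal (exp (t * k)) * indicator ?B X \<partial>seed_law lam)"
    using B by (rule nn_integral_cmult_indicator[symmetric])
  also have "\<dots> \<le> (\<integral>\<^sup>+X. (\<Prod>i<k. if node_at {l. even l} i X then weight t (X i) else 1)
      \<partial>seed_law lam)"
    using exp_le_prod_weight[OF assms(1)]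
    by (intro nn_integral_mono) (auto simp: indicator_def)
  also have "\<dots> \<le> 1"
    unfolding seed_law_def
    by (rule nn_integral_predictable_prod_le_1[OF assms(2) prefix_determined_node_at])
  finally have *: "ennreal (exp (t * k)) * emeasure (seed_law lam) ?B \<le> 1" .
  \<comment> \<open>Multiplying by the inverse exponential replaces the division in Markov's
    inequality.\<close>
  have "emeasure (seed_law lam) ?B
      = ennreal (exp (- t * k)) * (ennreal (exp (t * k)) * emeasure (seed_law lam) ?B)"
    by (simp add: mult.assoc[symmetric] ennreal_mult'[symmetric] exp_add[symmetric])
  also have "\<dots> \<le> ennreal (exp (- t * k)) * 1"
    by (rule mult_left_mono[OF *]) simp
  finally show ?thesis
    unfolding measure_def by (intro enn2real_leI) auto
qed

section \<open>Truncation of the seed\<close>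

definition truncate :: "nat \<Rightarrow> seed \<Rightarrow> seed" where
  "truncate k X i = (if i < k then X i else 0)"

lemma node_at_truncate: "i \<le> k \<Longrightarrow> node_at F i (truncate k X) = node_at F i X"
  by (rule prefix_determinedD[OF prefix_determined_node_at]) (simp add: truncate_def)

text \<open>Aliveness of \<open>k\<close> reads only entries below \<open>k\<close>, so it fails for
  the truncated seed too. All nodes of both trees then have labels below \<open>k\<close>, where the
  seeds agree.\<close>

lemma exists_node_event_truncate:
  assumes "\<not> alive X k"
  shows "truncate k X \<in> exists_node_event F m \<longleftrightarrow> X \<in> exists_node_event F m"
proof -
  have "\<not> alive (truncate k X) k"
    using assms alive_cong[of k X "truncate k X"] by (simp add: truncate_def)
  then have "i < k" if "alive X i \<or> alive (truncate k X) i" for i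
    using that assms alive_mono[of _ i k] by (meson linorder_not_less)
  then show ?thesis
    unfolding exists_node_event_eq mem_Collect_eq
    using node_at_truncate[of _ k F X] by (metis less_imp_le node_at_def truncate_def)
qed

lemma rapidly_determined_even_one_child_Un:
  assumes "0 \<le> lam\<^sub>0"
  shows "rapidly_determined lam\<^sub>0 lam\<^sub>1 (exists_node_event {l. even l} 1 \<union> exists_node_event F m)"
proof -
  let ?A = "exists_node_event {l. even l} 1"
  let ?D = "?A \<union> exists_node_event F m"
  let ?E = "\<lambda>k. {X. truncate k X \<in> ?D}"
  have pd: "prefix_determined k (\<lambda>X. truncate k X \<in> ?D)" for k
  proof (rule prefix_determinedI)
    fix X Y :: seed assume "\<And>i. i < k \<Longrightarrow> X i = Y i"
    then have "truncate k X = truncate k Y" by (auto simp: truncate_def)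
    then show "(truncate k X \<in> ?D) = (truncate k Y \<in> ?D)" by simp
  qed
  have D: "?D \<in> sets seed_space" by (intro sets.Un exists_node_event_sets)
  \<comment> \<open>Either the tree ends before label \<open>k\<close> and truncation changes
    nothing, or an even-level node with one child among the first \<open>k\<close> labels puts both
    seeds in \<open>?A\<close>. The bounding event mentions neither \<open>F\<close> nor
    \<open>m\<close>, so one estimate serves every second event.\<close>
  have error: "sym_diff ?D (?E k) \<subseteq> {X. undecided k X}" for k
  proof (rule subsetI, rule ccontr)
    fix X assume X: "X \<in> sym_diff ?D (?E k)" and "X \<notin> {X. undecided k X}"
    then consider "\<not> alive X k" | i where "i < k" "node_at {l. even l} i X" "X i = 1"
      by (auto simp: undecided_def)
    then show False
    proof cases
      case 1
      then show False using X exists_node_event_truncate by auto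
    next
      case 2
      then have "node_at {l. even l} i (truncate k X)" "truncate k X i = 1"
        using node_at_truncate[of i k] by (auto simp: truncate_def)
      then have "X \<in> ?A" "truncate k X \<in> ?A"
        using 2 by (auto simp: exists_node_event_eq node_at_def)
      then show False using X by auto
    qed
  qed
  have "\<exists>c>0. \<exists>C>0. \<exists>k\<^sub>0::nat. \<forall>k\<ge>1. k \<ge> k\<^sub>0 \<longrightarrow>
      measure (seed_law lam) (sym_diff ?D (?E k)) \<le> C * exp (- c * real k)"
    if "lam \<in> einterval lam\<^sub>0 lam\<^sub>1" for lam
  proof -
    \<comment> \<open>The interval is open, so \<open>lam\<close> is positive even if
      \<open>lam\<^sub>0 = 0\<close>.\<close>
    have "lam\<^sub>0 < ereal lam" using that by (simp add: einterval_def)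
    with assms have "0 < ereal lam" by (rule le_less_trans)
    then have "0 < lam" by simp
    then obtain t where t: "0 < t" "(\<integral>\<^sup>+n. weight t n \<partial>measure_pmf (poisson_pmf lam)) \<le> 1"
      by (rule exists_exponent)
    have "prob_space (seed_law lam)"
      unfolding seed_law_def by (intro prob_space_PiM prob_space_measure_pmf)
    then interpret prob_space "seed_law lam" .
    \<comment> \<open>The constants are \<open>c = t\<close> and \<open>C = 1\<close>, for all
      \<open>k\<close>. Here \<open>t\<close> depends on \<open>lam\<close>, but the approximating
      events do not.\<close>
    have "measure (seed_law lam) (sym_diff ?D (?E k)) \<le> 1 * exp (- t * real k)" for k
    proof -
      have "measure (seed_law lam) (sym_diff ?D (?E k))
          \<le> measure (seed_law lam) {X. undecided k X}"
        by (rule finite_measure_mono[OF error])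
          (simp add: sets_seed_law prefix_determined_seed_space[OF prefix_determined_undecided])
      then show ?thesis using measure_undecided_le[OF t, of k] by simp
    qed
    then show ?thesis using t(1) zero_less_one by blast
  qed
  then show ?thesis
    unfolding rapidly_determined_def
    using D tautologically_determinedI[OF pd] by (intro conjI exI[of _ ?E]) auto
qed

theorem proposition3p4:
  fixes lam\<^sub>0 lam\<^sub>1 :: ereal
  assumes "0 \<le> lam\<^sub>0" and "lam\<^sub>0 < lam\<^sub>1"
  shows "rapidly_determined lam\<^sub>0 lam\<^sub>1 (exists_node_event {l. even l} 1) \<and>
    (\<forall>F :: nat set.
       rapidly_determined lam\<^sub>0 lam\<^sub>1 (exists_node_event {l. even l} 1 \<union> exists_node_event F 2))"
proof -
  \<comment> \<open>With no admissible level the second event is empty, so the first claim is the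
    case \<open>F = {}\<close> of the second.\<close>
  have "exists_node_event {} 2 = {}" by (simp add: exists_node_event_def)
  then show ?thesis
    using rapidly_determined_even_one_child_Un[OF assms(1), of lam\<^sub>1 _ 2] by (metis Un_empty_right)
qed

end
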